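(* Let $X,Y$ be finite multisets of positive numbers. If $G=(X,Y)$ then $$o^-(G+\ast)=\begin{cases} \mathcal L&\text{if }\Delta(G)>1,\text{ or }\big(\Delta(G)\in\{0,1\}\text{ and }\epsilon(G)>0\big),\\ \mathcal R&\text{if }\Delta(G)<-1,\text{ or }\big(\Delta(G)\in\{0,-1\}\text{ and }\epsilon(G)<0\big),\\ \mathcal N&\text{if }\big(\Delta(G)=1\text{ and }\epsilon(G)\le 0\big)\text{ or }\big(\Delta(G)=-1\text{ and }\epsilon(G)\ge 0\big),\\ \mathcal P&\text{if }\Delta(G)=0\text{ and }\epsilon(G)=0. \end{cases}$$
   Context: Games are finite two-player (Left and Right) partizan game forms $G=\{\mathcal G^L\mid\mathcal G^R\}$, with disjunctive sum $G+H$; $0=\{\cdot\mid\cdot\}$ and $\ast=\{0\mid0\}$. Under misère play a player unable to move on their turn wins. $o^-(G)$ denotes the misère-play outcome class of $G$: $\mathcal L$ (Left wins whoever starts), $\mathcal R$ (Right wins whoever starts), $\mathcal N$ (the player who moves first wins), $\mathcal P$ (the player who moves second wins). Numbers are dyadic rationals, identified with their usual (normal-play canonical) game forms: $0=\{\cdot\mid\cdot\}$; $n=\{n-1\mid\cdot\}$ and $-n=\{\cdot\mid -(n-1)\}$ for positive integers $n$; $\frac{2p+1}{2^q}=\left\{\frac{p}{2^{q-1}}\,\middle|\,\frac{p+1}{2^{q-1}}\right\}$ for integers $p$ and $q\ge 1$. The ordinal sum is $G\!:\!H=\{\mathcal G^L,\,G\!:\!\mathcal H^L\mid \mathcal G^R,\,G\!:\!\mathcal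 H^R\}$. For finite multisets $X,Y$ of positive numbers, $(X,Y)=\sum_{x\in X}\ast\!:\!x+\sum_{y\in Y}\ast\!:\!(-y)$. Put $X'=X\setminus Y$ and $Y'=Y\setminus X$ (multiset differences). For $G=(X,Y)$, the advantage is $\Delta(G)=|X|-|Y|$ (counted with multiplicity) and the edge is $\epsilon(G)=\min(X')-\min(Y')$, with $\epsilon(G)=0$ if $X'$ or $Y'$ is empty. *)

theory Defs
  imports Complex_Main "HOL-Library.FSet" "HOL-Library.Multiset"
begin

section \<open>Game forms and disjunctive sum\<close>

datatype game = Game (left_opts: "game fset") (right_opts: "game fset")

lemma size_left_opts [termination_simp]: "g |\<in>| left_opts G \<Longrightarrow> size g < size G"
proof (cases G)
  case (Game A B)
  assume "g |\<in>| left_opts G"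
  with Game have "g \<in> fset A" by simp
  then have "Suc (size g) \<le> (\<Sum>x\<in>fset A. Suc (size x))"
    by (intro member_le_sum) auto
  with Game show ?thesis by simp
qed

lemma size_right_opts [termination_simp]: "g |\<in>| right_opts G \<Longrightarrow> size g < size G"
proof (cases G)
  case (Game A B)
  assume "g |\<in>| right_opts G"
  with Game have "g \<in> fset B" by simp
  then have "Suc (size g) \<le> (\<Sum>x\<in>fset B. Suc (size x))"
    by (intro member_le_sum) auto
  with Game show ?thesis by simp
qed

lemma game_options_induct [case_names step]:
  assumes "\<And>G. (\<And>g. g |\<in>| left_opts G \<Longrightarrow> P g) \<Longrightarrow> (\<And>g. g |\<in>| right_opts G \<Longrightarrow> P g) \<Longrightarrow> P G"
  shows "P G"
  by (induction G rule: measure_induct_rule[of size])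
     (blast intro: assms size_left_opts size_right_opts)

function game_sum :: "game \<Rightarrow> game \<Rightarrow> game" where
  "game_sum G H =
     Game ((\<lambda>g. game_sum g H) |`| left_opts G |\<union>| (\<lambda>h. game_sum G h) |`| left_opts H)
          ((\<lambda>g. game_sum g H) |`| right_opts G |\<union>| (\<lambda>h. game_sum G h) |`| right_opts H)"
  by pat_completeness auto
termination
  by (relation "measure (\<lambda>(G, H). size G + size H)")
     (auto dest: size_left_opts size_right_opts)

declare game_sum.simps [simp del]

lemma left_opts_game_sum:
  "left_opts (game_sum G H) =
     (\<lambda>g. game_sum g H) |`| left_opts G |\<union>| (\<lambda>h. game_sum G h) |`| left_opts H"
  by (subst game_sum.simps) simp

lemma right_opts_game_sum:
  "right_opts (game_sum G H) =
     (\<lambda>g. game_sum g H) |`| right_opts G |\<union>| (\<lambda>h. game_sum G h) |`| right_opts H"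
  by (subst game_sum.simps) simp

lemma game_sum_commute: "game_sum G H = game_sum H G"
proof (induction G H rule: game_sum.induct)
  case (1 G H)
  show ?case
  proof (rule game.expand, intro conjI)
    show "left_opts (game_sum G H) = left_opts (game_sum H G)"
      unfolding left_opts_game_sum using 1(1,2)
      by (subst sup_commute) (intro arg_cong2[where f = "(|\<union>|)"] fset.map_cong0; simp)
    show "right_opts (game_sum G H) = right_opts (game_sum H G)"
      unfolding right_opts_game_sum using 1(3,4)
      by (subst sup_commute) (intro arg_cong2[where f = "(|\<union>|)"] fset.map_cong0; simp)
  qed
qed

lemma game_sum_assoc: "game_sum (game_sum G H) K = game_sum G (game_sum H K)"
proof (induction "size G + size H + size K" arbitrary: G H K rule: less_induct)
  case less
  have L: "game_sum (game_sum g H) K = game_sum g (game_sum H K)"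
    if "g |\<in>| left_opts G \<or> g |\<in>| right_opts G" for g
    using that by (intro less) (auto dest: size_left_opts size_right_opts)
  have M: "game_sum (game_sum G h) K = game_sum G (game_sum h K)"
    if "h |\<in>| left_opts H \<or> h |\<in>| right_opts H" for h
    using that by (intro less) (auto dest: size_left_opts size_right_opts)
  have R: "game_sum (game_sum G H) k = game_sum G (game_sum H k)"
    if "k |\<in>| left_opts K \<or> k |\<in>| right_opts K" for k
    using that by (intro less) (auto dest: size_left_opts size_right_opts)
  show ?case
  proof (rule game.expand, intro conjI)
    show "left_opts (game_sum (game_sum G H) K) = left_opts (game_sum G (game_sum H K))"
      by (simp add: left_opts_game_sum fimage_funion fset.map_comp comp_def L M R sup_assoc
          cong: fset.map_cong)
    show "right_opts (game_sum (game_sum G H) K) = right_opts (game_sum G (game_sum H K))"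
      by (simp add: right_opts_game_sum fimage_funion fset.map_comp comp_def L M R sup_assoc
          cong: fset.map_cong)
  qed
qed

lemma game_sum_empty: "game_sum (Game {||} {||}) G = G"
proof (induction G rule: game_options_induct)
  case (step G)
  show ?case
  proof (rule game.expand, intro conjI)
    show "left_opts (game_sum (Game {||} {||}) G) = left_opts G"
      by (simp add: left_opts_game_sum step cong: fset.map_cong)
    show "right_opts (game_sum (Game {||} {||}) G) = right_opts G"
      by (simp add: right_opts_game_sum step cong: fset.map_cong)
  qed
qed

text \<open>
  Since options form sets, disjunctive sum is associative and commutative on forms, not just up to
  equivalence of games; hence finite disjunctive sums are the library's \<open>\<Sum>\<close>.
\<close>

instantiation game :: comm_monoid_add
begin

definition zero_game :: game where
  "0 = Game {||} {||}"

definition plus_game :: "game \<Rightarrow> game \<Rightarrow> game" where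
  "G + H = game_sum G H"

instance
proof
  fix a b c :: game
  show "a + b + c = a + (b + c)" by (simp add: plus_game_def game_sum_assoc)
  show "a + b = b + a" unfolding plus_game_def by (rule game_sum_commute)
  show "0 + a = a" by (simp add: zero_game_def plus_game_def game_sum_empty)
qed

end

definition star :: game where
  "star = Game {|0|} {|0|}"

function ordinal_sum :: "game \<Rightarrow> game \<Rightarrow> game" where
  "ordinal_sum G H =
     Game (left_opts G |\<union>| (\<lambda>h. ordinal_sum G h) |`| left_opts H)
          (right_opts G |\<union>| (\<lambda>h. ordinal_sum G h) |`| right_opts H)"
  by pat_completeness auto
termination
  by (relation "measure (\<lambda>(G, H). size H)") (auto dest: size_left_opts size_right_opts)

declare ordinal_sum.simps [simp del]


section \<open>Misere outcomes\<close>

text \<open>\<open>left_wins_first G\<close>: Left, moving first, wins \<open>G\<close> under misere play; dually for Right.\<close>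

function left_wins_first :: "game \<Rightarrow> bool" and right_wins_first :: "game \<Rightarrow> bool" where
  "left_wins_first G \<longleftrightarrow>
     left_opts G = {||} \<or> (\<exists>g|\<in>|left_opts G. \<not> right_wins_first g)"
| "right_wins_first G \<longleftrightarrow>
     right_opts G = {||} \<or> (\<exists>g|\<in>|right_opts G. \<not> left_wins_first g)"
  by pat_completeness auto
termination
  by (relation "measure (case_sum size size)") (auto dest: size_left_opts size_right_opts)

declare left_wins_first.simps [simp del] right_wins_first.simps [simp del]

datatype outcome = Outcome_L | Outcome_R | Outcome_N | Outcome_P

definition misere_outcome :: "game \<Rightarrow> outcome" where
  "misere_outcome G =
     (if left_wins_first G
      then (if right_wins_first G then Outcome_N else Outcome_L)
      else (if right_wins_first G then Outcome_R else Outcome_P))"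


section \<open>Numbers and their canonical forms\<close>

definition dyadic :: "rat \<Rightarrow> bool" where
  "dyadic x \<longleftrightarrow> (\<exists>(p::int) (q::nat). x = of_int p / 2 ^ q)"

primrec nat_form :: "nat \<Rightarrow> game" where
  "nat_form 0 = 0"
| "nat_form (Suc n) = Game {|nat_form n|} {||}"

primrec neg_nat_form :: "nat \<Rightarrow> game" where
  "neg_nat_form 0 = 0"
| "neg_nat_form (Suc n) = Game {||} {|neg_nat_form n|}"

text \<open>\<open>dyadic_form q p\<close> is the canonical form of the number \<open>p / 2 ^ q\<close>, not necessarily reduced.\<close>

primrec dyadic_form :: "nat \<Rightarrow> int \<Rightarrow> game" where
  "dyadic_form 0 p = (if p \<ge> 0 then nat_form (nat p) else neg_nat_form (nat (- p)))"
| "dyadic_form (Suc q) p =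
     (if even p then dyadic_form q (p div 2)
      else Game {|dyadic_form q (p div 2)|} {|dyadic_form q (p div 2 + 1)|})"

text \<open>Only meaningful if \<open>dyadic x\<close>; any exponent of a representation gives the same form.\<close>

definition number_form :: "rat \<Rightarrow> game" where
  "number_form x = (let q = (LEAST q. x * 2 ^ q \<in> \<int>) in dyadic_form q \<lfloor>x * 2 ^ q\<rfloor>)"

lemma dyadic_form_add: "dyadic_form (q + k) (p * 2 ^ k) = dyadic_form q p"
  by (induction k) (simp_all flip: mult.assoc add: mult.commute[of _ 2] mult.left_commute[of _ 2])

lemma number_form_dyadic: "number_form (of_int p / 2 ^ q) = dyadic_form q p"
proof -
  define x :: rat where "x = of_int p / 2 ^ q"
  define m where "m = (LEAST q. x * 2 ^ q \<in> \<int>)"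
  have xq: "x * 2 ^ q = of_int p" by (simp add: x_def)
  then have q: "x * 2 ^ q \<in> \<int>" by simp
  have "x * 2 ^ m \<in> \<int>" unfolding m_def using q by (rule LeastI)
  then obtain a where a: "x * 2 ^ m = of_int a" by (auto elim: Ints_cases)
  have "m \<le> q" unfolding m_def using q by (rule Least_le)
  then obtain k where k: "q = m + k" using le_Suc_ex by blast
  have "of_int p = (of_int a :: rat) * 2 ^ k"
    using xq a by (simp add: k power_add flip: mult.assoc)
  also have "\<dots> = of_int (a * 2 ^ k)" by simp
  finally have "p = a * 2 ^ k" by (simp only: of_int_eq_iff)
  then have "dyadic_form q p = dyadic_form m a" by (simp add: k dyadic_form_add)
  moreover have "number_form x = dyadic_form m a"
    unfolding number_form_def Let_def m_def[symmetric] by (simp add: a)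
  ultimately show ?thesis by (simp add: x_def)
qed

lemma number_form_0: "number_form 0 = Game {||} {||}"
  using number_form_dyadic[of 0 0] by (simp add: zero_game_def)

lemma number_form_pos_int:
  assumes "n > 0"
  shows "number_form (of_nat n) = Game {|number_form (of_nat n - 1)|} {||}"
proof -
  obtain m where m: "n = Suc m" using assms gr0_implies_Suc by blast
  show ?thesis
    using number_form_dyadic[of "int n" 0] number_form_dyadic[of "int m" 0]
    by (simp add: m nat_add_distrib)
qed

lemma number_form_neg_int:
  assumes "n > 0"
  shows "number_form (- of_nat n) = Game {||} {|number_form (- (of_nat n - 1))|}"
proof -
  obtain m where m: "n = Suc m" using assms gr0_implies_Suc by blast
  show ?thesis
    using number_form_dyadic[of "- int n" 0] number_form_dyadic[of "- int m" 0]
    by (cases "m = 0") (auto simp: m nat_add_distrib)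
qed

lemma number_form_frac:
  assumes "q \<ge> 1"
  shows "number_form (of_int (2 * p + 1) / 2 ^ q) =
    Game {|number_form (of_int p / 2 ^ (q - 1))|} {|number_form (of_int (p + 1) / 2 ^ (q - 1))|}"
proof -
  obtain r where r: "q = Suc r" using assms by (cases q) auto
  show ?thesis unfolding number_form_dyadic by (simp add: r)
qed


section \<open>Sums of ordinal sums of star with numbers\<close>

definition star_sum :: "rat multiset \<Rightarrow> rat multiset \<Rightarrow> game" where
  "star_sum X Y =
     (\<Sum>x\<in>#X. ordinal_sum star (number_form x)) + (\<Sum>y\<in>#Y. ordinal_sum star (number_form (- y)))"

definition advantage :: "rat multiset \<Rightarrow> rat multiset \<Rightarrow> int" where
  "advantage X Y = int (size X) - int (size Y)"

definition edge :: "rat multiset \<Rightarrow> rat multiset \<Rightarrow> rat" where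
  "edge X Y =
     (if X - Y = {#} \<or> Y - X = {#} then 0 else Min (set_mset (X - Y)) - Min (set_mset (Y - X)))"

end

theory Submission
  imports Defs
begin

text \<open>
  In \<open>\<star>:x\<close> with \<open>x > 0\<close> either player may move to \<open>0\<close>, Left may also lower \<open>x\<close> to its Left option
  (reaching \<open>\<star>:0 = \<star>\<close> if that option is \<open>0\<close>), and Right may also raise \<open>x\<close> to its Right option; in
  \<open>\<star>:(-y)\<close> the roles are exchanged. So every position reachable from \<open>(X,Y) + \<star>\<close> is again of the form
  \<open>(X,Y) + k\<cdot>\<star>\<close> with \<open>X\<close> and \<open>Y\<close> consisting of positive numbers, and the game can be played on the
  triples \<open>(X, Y, k)\<close>. Seen from the player to move, who owns \<open>X\<close>, the legal moves are the relation
  \<open>move\<close>; exchanging \<open>X\<close> and \<open>Y\<close> turns Left's moves into Right's, so one relation and one analysis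
  serve both players.

  The player to move wins \<open>(X, Y, k)\<close> exactly when \<open>winning X Y k\<close> holds. Only the parity of \<open>k\<close> matters.
  For even \<open>k\<close> the sizes decide: the player to move wins iff \<open>|X| \<ge> |Y|\<close>, by removing a component
  of the opponent or, if there is none, by a waiting move. For odd \<open>k\<close> a strict majority wins, since
  removing one \<open>\<star>\<close> leaves the opponent in a minority with an even number of stars; if \<open>|X|\<close> is \<open>|Y|\<close>
  or \<open>|Y| - 1\<close>, the winner is decided by a strict total order on multisets, \<open>below\<close>, which looks at
  the smallest number whose multiplicities in \<open>X\<close> and \<open>Y\<close> differ.

  That order replaces the edge: \<open>below X Y\<close> holds if the edge is negative, and among multisets of
  equal or adjacent sizes an edge of zero means equality or one multiset extending the other by
  one element. Its merit is that
  the moves of a player which the sizes alone do not settle (lowering an own number, removing or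
  raising one of the opponent) all change the multisets in the same direction of the order. Hence
  transitivity shows that no move escapes from a losing position (\<open>move_from_losing\<close>).
  Conversely, when \<open>below Y X\<close> holds
  and the sizes are equal or one apart, a good move is to remove an element of \<open>Y\<close> while keeping the
  least one by which \<open>Y\<close> is ahead. If that one, \<open>m\<close>, is the only element of the difference, then either
  its removal makes the multisets equal, or \<open>X\<close> and \<open>Y\<close> differ in a single pair of numbers \<open>m < x\<close>; then
  \<open>x\<close> can be lowered without passing below \<open>m\<close>, or \<open>m\<close> raised without passing above \<open>x\<close>
  (\<open>lower_or_raise_between\<close>), which is the usual simplicity property of canonical forms.
\<close>

section \<open>Options of canonical forms\<close>

text \<open>The exponent of the denominator of a dyadic rational in lowest terms.\<close>

definition den_exp :: "rat \<Rightarrow> nat" where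
  "den_exp x = (LEAST q. x * 2 ^ q \<in> \<int>)"

text \<open>
  For a positive dyadic rational, \<open>lower\<close> is the Left option of the canonical form and \<open>raise\<close> is its
  Right option, which exists only for non-integers.
\<close>

definition lower :: "rat \<Rightarrow> rat" where
  "lower x = x - 1 / 2 ^ den_exp x"

definition raise :: "rat \<Rightarrow> rat" where
  "raise x = x + 1 / 2 ^ den_exp x"

lemma lower_less: "lower x < x" and raise_greater: "x < raise x"
  by (simp_all add: lower_def raise_def)

lemma den_exp_reduced:
  assumes "dyadic x"
  obtains p where "x = of_int p / 2 ^ den_exp x" and "den_exp x = 0 \<or> odd p"
proof -
  obtain p0 :: int and q0 :: nat where "x = of_int p0 / 2 ^ q0"
    using assms by (auto simp: dyadic_def)
  then have "x * 2 ^ q0 \<in> \<int>" by simp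
  then have "x * 2 ^ den_exp x \<in> \<int>" unfolding den_exp_def by (rule LeastI)
  then obtain p where p: "x * 2 ^ den_exp x = of_int p" by (auto elim: Ints_cases)
  have "odd p" if nonzero: "den_exp x \<noteq> 0"
  proof
    assume "even p"
    then obtain r where r: "p = 2 * r" by blast
    obtain q where q: "den_exp x = Suc q" using nonzero not0_implies_Suc by blast
    have "2 * (x * 2 ^ q) = 2 * of_int r" using p unfolding q r by (simp add: mult_ac)
    then have "x * 2 ^ q = of_int r" by (simp only: mult_cancel_left) simp
    then have "x * 2 ^ q \<in> \<int>" by simp
    then have "den_exp x \<le> q" unfolding den_exp_def by (rule Least_le)
    with q show False by simp
  qed
  then have reduced: "den_exp x = 0 \<or> odd p" by blast
  have "x = of_int p / 2 ^ den_exp x" using p by (simp add: eq_divide_eq)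
  then show thesis using reduced by (rule that)
qed

lemma dyadic_lower: "dyadic x \<Longrightarrow> dyadic (lower x)"
  and dyadic_raise: "dyadic x \<Longrightarrow> dyadic (raise x)"
proof -
  assume "dyadic x"
  then obtain p where p: "x = of_int p / 2 ^ den_exp x" using den_exp_reduced by blast
  from p have "lower x = of_int (p - 1) / 2 ^ den_exp x"
    unfolding lower_def by (metis diff_divide_distrib of_int_1 of_int_diff)
  then show "dyadic (lower x)" unfolding dyadic_def by blast
  from p have "raise x = of_int (p + 1) / 2 ^ den_exp x"
    unfolding raise_def by (metis add_divide_distrib of_int_1 of_int_add)
  then show "dyadic (raise x)" unfolding dyadic_def by blast
qed

lemma lower_nonneg:
  assumes "dyadic x" and "x > 0"
  shows "lower x \<ge> 0"
proof -
  obtain p where p: "x = of_int p / 2 ^ den_exp x" using den_exp_reduced assms(1) by blast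
  with assms(2) have "p > 0"
    by (metis of_int_0_less_iff zero_less_divide_iff zero_less_numeral zero_less_power
        not_less_iff_gr_or_eq)
  then have "(1::rat) \<le> of_int p" by simp
  then have "1 / 2 ^ den_exp x \<le> x" by (subst (2) p) (simp add: divide_right_mono)
  then show ?thesis by (simp add: lower_def)
qed

text \<open>Both numbers are multiples of \<open>1 / 2 ^ d\<close>, so distinct ones differ by at least that much.\<close>

lemma dyadic_gap:
  assumes "x = of_int p / 2 ^ d" and "y = of_int r / 2 ^ e" and "e \<le> d" and "y < x"
  shows "y + 1 / 2 ^ d \<le> (x :: rat)"
proof -
  obtain k where k: "d = e + k" using assms(3) le_Suc_ex by blast
  have y: "y = of_int (r * 2 ^ k) / 2 ^ d" by (simp add: assms(2) k power_add)
  have "r * 2 ^ k < p"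
    using assms(4) unfolding y assms(1)
    by (simp add: divide_less_cancel flip: of_int_less_iff[where ?'a = rat])
  then have "of_int (r * 2 ^ k + 1) \<le> (of_int p :: rat)" by (subst of_int_le_iff) simp
  then have "of_int (r * 2 ^ k + 1) / 2 ^ d \<le> x"
    unfolding assms(1) by (simp add: divide_right_mono)
  then show ?thesis unfolding y by (simp add: add_divide_distrib)
qed

text \<open>
  Whichever of the two numbers has the larger denominator can be moved towards the other by one
  unit of that denominator without overtaking it. If it has to be \<open>y\<close>, because its denominator is
  strictly larger, then \<open>y\<close> is not an integer and so does have a Right option.
\<close>

lemma lower_or_raise_between:
  assumes "dyadic x" and "dyadic y" and "y < x"
  shows "y \<le> lower x \<or> (den_exp y \<noteq> 0 \<and> raise y \<le> x)"
proof -
  obtain p where p: "x = of_int p / 2 ^ den_exp x" using den_exp_reduced assms(1) by blast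
  obtain r where r: "y = of_int r / 2 ^ den_exp y" using den_exp_reduced assms(2) by blast
  show ?thesis
  proof (cases "den_exp y \<le> den_exp x")
    case True
    then show ?thesis using dyadic_gap[OF p r True assms(3)] by (simp add: lower_def)
  next
    case False
    have "- y = of_int (- r) / 2 ^ den_exp y" "- x = of_int (- p) / 2 ^ den_exp x"
      using p r by (metis minus_divide_left of_int_minus)+
    from dyadic_gap[OF this] False assms(3) show ?thesis by (simp add: raise_def)
  qed
qed

lemma number_form_as_game:
  assumes "dyadic x" and "x > 0"
  shows "number_form x =
      Game {|number_form (lower x)|} (if den_exp x = 0 then {||} else {|number_form (raise x)|})"
    and "number_form (- x) =
      Game (if den_exp x = 0 then {||} else {|number_form (- raise x)|}) {|number_form (- lower x)|}"
proof -
  obtain p where p: "x = of_int p / 2 ^ den_exp x" and odd: "den_exp x = 0 \<or> odd p"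
    using den_exp_reduced assms(1) by blast
  have "number_form x =
      Game {|number_form (lower x)|} (if den_exp x = 0 then {||} else {|number_form (raise x)|}) \<and>
    number_form (- x) =
      Game (if den_exp x = 0 then {||} else {|number_form (- raise x)|}) {|number_form (- lower x)|}"
  proof (cases "den_exp x = 0")
    case True
    define n where "n = nat p"
    from p have "x = of_int p" unfolding True by simp
    with assms(2) have n: "of_nat n = x" "n > 0" by (simp_all add: n_def)
    have "lower x = x - 1" by (simp add: lower_def True)
    with number_form_pos_int[OF n(2)] number_form_neg_int[OF n(2)] show ?thesis
      by (simp add: n(1) True)
  next
    case False
    with odd obtain r where r: "p = 2 * r + 1" by (auto elim: oddE)
    obtain q where q: "den_exp x = Suc q" using False not0_implies_Suc by blast
    have x: "x = of_int (2 * r + 1) / 2 ^ Suc q" using p unfolding r q .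
    then have mx: "- x = of_int (2 * (- r - 1) + 1) / 2 ^ Suc q" by (simp add: field_simps)
    have l: "lower x = of_int r / 2 ^ q" and h: "raise x = of_int (r + 1) / 2 ^ q"
      unfolding lower_def raise_def q by (simp_all add: x field_simps)
    have ml: "- lower x = of_int (- r - 1 + 1) / 2 ^ q" and mh: "- raise x = of_int (- r - 1) / 2 ^ q"
      unfolding l h by (simp_all add: field_simps)
    have "number_form x = Game {|number_form (lower x)|} {|number_form (raise x)|}"
      unfolding l h by (subst x, subst number_form_frac) simp_all
    moreover have "number_form (- x) = Game {|number_form (- raise x)|} {|number_form (- lower x)|}"
      unfolding ml mh by (subst mx, subst number_form_frac) simp_all
    ultimately show ?thesis using False by simp
  qed
  then show "number_form x =
      Game {|number_form (lower x)|} (if den_exp x = 0 then {||} else {|number_form (raise x)|})"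
    and "number_form (- x) =
      Game (if den_exp x = 0 then {||} else {|number_form (- raise x)|}) {|number_form (- lower x)|}"
    by blast+
qed


section \<open>Positions and moves\<close>

abbreviation up :: "rat \<Rightarrow> game" where
  "up x \<equiv> ordinal_sum star (number_form x)"

abbreviation down :: "rat \<Rightarrow> game" where
  "down y \<equiv> ordinal_sum star (number_form (- y))"

definition position :: "rat multiset \<Rightarrow> rat multiset \<Rightarrow> nat \<Rightarrow> game" where
  "position X Y k = star_sum X Y + (\<Sum>s\<in>#replicate_mset k star. s)"

definition all_positive :: "rat multiset \<Rightarrow> bool" where
  "all_positive X \<longleftrightarrow> (\<forall>x\<in>#X. dyadic x \<and> x > 0)"

lemma all_positive_simps [simp]:
  "all_positive {#}"
  "all_positive (add_mset x X) \<longleftrightarrow> dyadic x \<and> x > 0 \<and> all_positive X"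
  by (auto simp: all_positive_def)

text \<open>
  The first multiset belongs to the player who moves, both before and after the move. A number
  lowered to \<open>0\<close> becomes a further \<open>\<star>\<close>, which keeps all entries of the multisets positive.
\<close>

inductive move ::
  "rat multiset \<Rightarrow> rat multiset \<Rightarrow> nat \<Rightarrow> rat multiset \<Rightarrow> rat multiset \<Rightarrow> nat \<Rightarrow> bool" where
  remove_own: "move (add_mset x X) Y k X Y k"
| remove_other: "move X (add_mset y Y) k X Y k"
| lower_own: "lower x > 0 \<Longrightarrow> move (add_mset x X) Y k (add_mset (lower x) X) Y k"
| own_to_star: "lower x = 0 \<Longrightarrow> move (add_mset x X) Y k X Y (Suc k)"
| raise_other: "den_exp y \<noteq> 0 \<Longrightarrow> move X (add_mset y Y) k X (add_mset (raise y) Y) k"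
| remove_star: "move X Y (Suc k) X Y k"

lemma move_all_positive:
  assumes "move X Y k X' Y' k'" and "all_positive X" and "all_positive Y"
  shows "all_positive X' \<and> all_positive Y'"
  using assms
  by induction (auto simp: dyadic_lower dyadic_raise intro: less_trans[OF _ raise_greater])

text \<open>
  Stating the facts on options for a selector \<open>opts\<close> lets one proof serve both players.
\<close>

lemma option_of_sum_mset_iff:
  assumes opts: "opts = left_opts \<or> opts = right_opts"
  shows "g |\<in>| opts (\<Sum>\<^sub># M) \<longleftrightarrow> (\<exists>c N h. M = add_mset c N \<and> h |\<in>| opts c \<and> g = h + \<Sum>\<^sub># N)"
proof (induction M arbitrary: g)
  case empty
  then show ?case using opts by (auto simp: zero_game_def)
next
  case (add a M)
  have plus: "g |\<in>| opts (G + H) \<longleftrightarrow>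
      (\<exists>h. h |\<in>| opts G \<and> g = h + H) \<or> (\<exists>h. h |\<in>| opts H \<and> g = G + h)" for G H
    using opts by (auto simp: plus_game_def left_opts_game_sum right_opts_game_sum)
  show ?case
  proof
    assume "g |\<in>| opts (\<Sum>\<^sub># (add_mset a M))"
    then consider (head) h where "h |\<in>| opts a" "g = h + \<Sum>\<^sub># M"
      | (tail) h where "h |\<in>| opts (\<Sum>\<^sub># M)" "g = a + h"
      by (auto simp: plus)
    then show "\<exists>c N h. add_mset a M = add_mset c N \<and> h |\<in>| opts c \<and> g = h + \<Sum>\<^sub># N"
    proof cases
      case head
      then show ?thesis by blast
    next
      case tail
      from tail(1) obtain c N h' where "M = add_mset c N" "h' |\<in>| opts c" "h = h' + \<Sum>\<^sub># N"
        unfolding add.IH by blast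
      with tail(2) have "add_mset a M = add_mset c (add_mset a N)" "h' |\<in>| opts c"
        "g = h' + \<Sum>\<^sub># (add_mset a N)"
        by (simp_all add: ac_simps)
      then show ?thesis by blast
    qed
  next
    assume "\<exists>c N h. add_mset a M = add_mset c N \<and> h |\<in>| opts c \<and> g = h + \<Sum>\<^sub># N"
    then obtain c N h where eq: "add_mset a M = add_mset c N" and h: "h |\<in>| opts c"
      and g: "g = h + \<Sum>\<^sub># N" by blast
    have "\<Sum>\<^sub># (add_mset a M) = c + \<Sum>\<^sub># N" unfolding eq by simp
    then show "g |\<in>| opts (\<Sum>\<^sub># (add_mset a M))" using h g plus by auto
  qed
qed

lemma add_mset_eq_union3D:
  assumes "A + B + C = add_mset c N"
  shows "(\<exists>A'. A = add_mset c A' \<and> N = A' + B + C) \<or> (\<exists>B'. B = add_mset c B' \<and> N = A + B' + C) \<or>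
    (\<exists>C'. C = add_mset c C' \<and> N = A + B + C')"
proof -
  have "c \<in># A \<or> c \<in># B \<or> c \<in># C" using assms by (metis union_iff union_single_eq_member)
  then show ?thesis using assms
    by (elim disjE) (auto dest!: multi_member_split)
qed

text \<open>
  With \<open>f\<close> and \<open>g\<close> as the components owned by the player to move and by the opponent, this covers
  Left's options (\<open>f = up\<close>, \<open>g = down\<close>) and Right's (\<open>f = down\<close>, \<open>g = up\<close>).
\<close>

lemma option_iff_move:
  fixes f g :: "rat \<Rightarrow> game"
  defines "pos \<equiv> \<lambda>X Y k. \<Sum>\<^sub># (image_mset f X + image_mset g Y + replicate_mset k star)"
  assumes opts: "opts = left_opts \<or> opts = right_opts"
    and f: "\<And>x. dyadic x \<Longrightarrow> x > 0 \<Longrightarrow> opts (f x) = {|0, f (lower x)|}"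
    and g: "\<And>y. dyadic y \<Longrightarrow> y > 0 \<Longrightarrow>
      opts (g y) = finsert 0 (if den_exp y = 0 then {||} else {|g (raise y)|})"
    and f0: "f 0 = star"
    and X: "all_positive X" and Y: "all_positive Y"
  shows "v |\<in>| opts (pos X Y k) \<longleftrightarrow> (\<exists>X' Y' k'. move X Y k X' Y' k' \<and> v = pos X' Y' k')"
proof
  have star: "opts star = {|0|}" using opts by (auto simp: star_def)
  {
    assume "v |\<in>| opts (pos X Y k)"
    then obtain c N h where "image_mset f X + image_mset g Y + replicate_mset k star = add_mset c N"
      and h: "h |\<in>| opts c" and v: "v = h + \<Sum>\<^sub># N"
      unfolding pos_def option_of_sum_mset_iff[OF opts] by blast
    from add_mset_eq_union3D[OF this(1)]
    consider (own) x X0 where "X = add_mset x X0" "c = f x"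
        "N = image_mset f X0 + image_mset g Y + replicate_mset k star"
      | (other) y Y0 where "Y = add_mset y Y0" "c = g y"
        "N = image_mset f X + image_mset g Y0 + replicate_mset k star"
      | (nimber) k0 where "k = Suc k0" "c = star"
        "N = image_mset f X + image_mset g Y + replicate_mset k0 star"
    proof (elim disjE exE conjE)
      fix A' assume "image_mset f X = add_mset c A'" "N = A' + image_mset g Y + replicate_mset k star"
      then show thesis using own by (auto dest!: msed_map_invR)
    next
      fix B' assume "image_mset g Y = add_mset c B'" "N = image_mset f X + B' + replicate_mset k star"
      then show thesis using other by (auto dest!: msed_map_invR)
    next
      fix C' assume "replicate_mset k star = add_mset c C'" "N = image_mset f X + image_mset g Y + C'"
      moreover from this(1) have "c = star"
        by (metis in_replicate_mset union_single_eq_member)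
      ultimately show thesis using nimber by (cases k) auto
    qed
    then show "\<exists>X' Y' k'. move X Y k X' Y' k' \<and> v = pos X' Y' k'"
    proof cases
      case own
      with X have x: "dyadic x" "x > 0" by auto
      from h own f[OF x] consider "h = 0" | "h = f (lower x)" by auto
      then show ?thesis
      proof cases
        case 1
        then show ?thesis using own v move.remove_own unfolding pos_def by fastforce
      next
        case 2
        show ?thesis
        proof (cases "lower x = 0")
          case True
          with 2 own v f0 have "v = pos X0 Y (Suc k)" by (simp add: pos_def ac_simps)
          then show ?thesis using own(1) move.own_to_star[OF True] by blast
        next
          case False
          with lower_nonneg[OF x] have positive: "lower x > 0" by simp
          from 2 own v have "v = pos (add_mset (lower x) X0) Y k" by (simp add: pos_def ac_simps)
          then show ?thesis using own(1) move.lower_own[OF positive] by blast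
        qed
      qed
    next
      case other
      with Y have y: "dyadic y" "y > 0" by auto
      from h other g[OF y] consider "h = 0" | "den_exp y \<noteq> 0" "h = g (raise y)"
        by (auto split: if_splits)
      then show ?thesis
      proof cases
        case 1
        then show ?thesis using other v move.remove_other unfolding pos_def by fastforce
      next
        case 2
        with other v have "v = pos X (add_mset (raise y) Y0) k" by (simp add: pos_def ac_simps)
        then show ?thesis using other(1) move.raise_other[OF 2(1)] by blast
      qed
    next
      case nimber
      with h star v have "v = pos X Y k0" by (simp add: pos_def)
      then show ?thesis using nimber(1) move.remove_star by blast
    qed
  }
  {
    assume "\<exists>X' Y' k'. move X Y k X' Y' k' \<and> v = pos X' Y' k'"
    then obtain X' Y' k' where "move X Y k X' Y' k'" and v: "v = pos X' Y' k'" by blast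
    have optionI: "h |\<in>| opts c \<Longrightarrow>
        image_mset f X + image_mset g Y + replicate_mset k star = add_mset c N \<Longrightarrow>
        v = h + \<Sum>\<^sub># N \<Longrightarrow> v |\<in>| opts (pos X Y k)" for c N h
      unfolding pos_def option_of_sum_mset_iff[OF opts] by blast
    from \<open>move X Y k X' Y' k'\<close> show "v |\<in>| opts (pos X Y k)"
    proof cases
      case (remove_own x)
      with X f[of x] have "0 |\<in>| opts (f x)" by simp
      then show ?thesis
        by (rule optionI[where N = "image_mset f X' + image_mset g Y + replicate_mset k star"])
          (simp_all add: v pos_def remove_own)
    next
      case (remove_other y)
      with Y g[of y] have "0 |\<in>| opts (g y)" by simp
      then show ?thesis
        by (rule optionI[where N = "image_mset f X + image_mset g Y' + replicate_mset k star"])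
          (simp_all add: v pos_def remove_other)
    next
      case (lower_own x X0)
      with X f[of x] have "f (lower x) |\<in>| opts (f x)" by simp
      then show ?thesis
        by (rule optionI[where N = "image_mset f X0 + image_mset g Y + replicate_mset k star"])
          (simp_all add: v pos_def lower_own ac_simps)
    next
      case (own_to_star x)
      with X f[of x] f0 have "star |\<in>| opts (f x)" by simp
      then show ?thesis
        by (rule optionI[where N = "image_mset f X' + image_mset g Y + replicate_mset k star"])
          (simp_all add: v pos_def own_to_star ac_simps)
    next
      case (raise_other y Y0)
      with Y g[of y] have "g (raise y) |\<in>| opts (g y)" by simp
      then show ?thesis
        by (rule optionI[where N = "image_mset f X + image_mset g Y0 + replicate_mset k star"])
          (simp_all add: v pos_def raise_other ac_simps)
    next
      case remove_star
      from star have "0 |\<in>| opts star" by simp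
      then show ?thesis
        by (rule optionI[where N = "image_mset f X + image_mset g Y + replicate_mset k' star"])
          (simp_all add: v pos_def remove_star)
    qed
  }
qed

lemma left_opts_ordinal_sum_star:
    "left_opts (ordinal_sum star H) = finsert 0 (ordinal_sum star |`| left_opts H)"
  and right_opts_ordinal_sum_star:
    "right_opts (ordinal_sum star H) = finsert 0 (ordinal_sum star |`| right_opts H)"
  by (subst ordinal_sum.simps; simp add: star_def)+

lemma ordinal_sum_star_0: "ordinal_sum star (number_form 0) = star"
  by (subst ordinal_sum.simps) (simp add: number_form_0 star_def)

lemma left_option_iff_move:
  assumes "all_positive X" and "all_positive Y"
  shows "v |\<in>| left_opts (position X Y k) \<longleftrightarrow>
    (\<exists>X' Y' k'. move X Y k X' Y' k' \<and> v = position X' Y' k')"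
proof -
  have pos: "position X Y k =
      \<Sum>\<^sub># (image_mset up X + image_mset down Y + replicate_mset k star)" for X Y k
    by (simp add: position_def star_sum_def)
  show ?thesis unfolding pos
    by (rule option_iff_move)
      (use assms in \<open>auto simp: left_opts_ordinal_sum_star number_form_as_game ordinal_sum_star_0\<close>)
qed

lemma right_option_iff_move:
  assumes "all_positive X" and "all_positive Y"
  shows "v |\<in>| right_opts (position X Y k) \<longleftrightarrow>
    (\<exists>X' Y' k'. move Y X k Y' X' k' \<and> v = position X' Y' k')"
proof -
  have pos: "position X Y k =
      \<Sum>\<^sub># (image_mset down Y + image_mset up X + replicate_mset k star)" for X Y k
    by (simp add: position_def star_sum_def ac_simps)
  have "v |\<in>| right_opts (position X Y k) \<longleftrightarrow> (\<exists>Y' X' k'. move Y X k Y' X' k' \<and>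
      v = \<Sum>\<^sub># (image_mset down Y' + image_mset up X' + replicate_mset k' star))"
    unfolding pos by (rule option_iff_move)
      (use assms in \<open>auto simp: right_opts_ordinal_sum_star number_form_as_game ordinal_sum_star_0\<close>)
  then show ?thesis unfolding pos by blast
qed


section \<open>The order that decides equal or nearly equal sizes\<close>

text \<open>
  \<open>below X Y\<close> says that \<open>X \<noteq> Y\<close> and that the smallest number with different multiplicities in \<open>X\<close> and \<open>Y\<close>
  occurs more often in \<open>X\<close>. It is the lexicographic order on increasing enumerations where an
  exhausted enumeration counts as continuing with infinity, so a proper extension of a multiset is
  below it. As the multiset extension of the reversed order on numbers it is a strict
  total order.
\<close>

abbreviation below :: "rat multiset \<Rightarrow> rat multiset \<Rightarrow> bool" where
  "below X Y \<equiv> multp (>) Y X"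

lemma below_trans: "below X Y \<Longrightarrow> below Y Z \<Longrightarrow> below X Z"
  using transp_multp[of "(>) :: rat \<Rightarrow> _"] by (metis transpD transp_on_greater)

lemma below_irrefl: "\<not> below X X"
  using irreflp_multp[of "(>) :: rat \<Rightarrow> _"] by (metis irreflpD irreflp_on_greater transp_on_greater)

lemma below_total: "X \<noteq> Y \<Longrightarrow> below X Y \<or> below Y X"
  using totalp_multp[of "(>) :: rat \<Rightarrow> _"] by (metis totalpD totalp_on_greater transp_on_greater)

lemma below_add_mset: "below (add_mset x X) X"
  by (simp add: subset_implies_multp)

lemma below_replace: "x < y \<Longrightarrow> below (add_mset x X) (add_mset y X)"
  using one_step_implies_multp[of "{#x#}" "{#y#}" "(>)" X] by simp

text \<open>
  Common elements cancel, which brings in the differences that define the edge.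
\<close>

lemma below_iff:
  "below X Y \<longleftrightarrow> X - Y \<noteq> {#} \<and> (\<forall>y\<in>#Y - X. \<exists>x\<in>#X - Y. x < y)"
proof -
  have *: "below X Y \<longleftrightarrow> multp (>) (Y - X) (X - Y)"
    by (rule multp_cancel_max) (auto intro: irreflp_onI)
  show ?thesis
  proof
    assume "below X Y"
    with * obtain I J K where IJ: "X - Y = I + J" and IK: "Y - X = I + K" and "J \<noteq> {#}"
      and dom: "\<forall>k\<in>#K. \<exists>x\<in>#J. k > x"
      using multp_implies_one_step[of "(>)" "Y - X" "X - Y"] by auto
    \<comment> \<open>the two differences have no element in common\<close>
    moreover have "I = {#}"
    proof (rule multiset_eqI)
      fix a
      have "count (X - Y) a = 0 \<or> count (Y - X) a = 0" by auto
      then show "count I a = count {#} a" unfolding IJ IK by auto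
    qed
    ultimately show "X - Y \<noteq> {#} \<and> (\<forall>y\<in>#Y - X. \<exists>x\<in>#X - Y. x < y)" by simp
  next
    assume "X - Y \<noteq> {#} \<and> (\<forall>y\<in>#Y - X. \<exists>x\<in>#X - Y. x < y)"
    then show "below X Y"
      unfolding * using one_step_implies_multp[of "X - Y" "Y - X" "(>)" "{#}"] by simp
  qed
qed

lemma edge_swap: "edge Y X = - edge X Y"
  by (auto simp: edge_def)

lemma below_if_edge_neg:
  assumes "edge X Y < 0"
  shows "below X Y"
proof -
  from assms have ne: "X - Y \<noteq> {#}" "Y - X \<noteq> {#}"
    and less: "Min (set_mset (X - Y)) < Min (set_mset (Y - X))"
    by (auto simp: edge_def split: if_splits)
  have "Min (set_mset (X - Y)) \<in># X - Y" using ne by (intro Min_in) auto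
  moreover have "Min (set_mset (X - Y)) < y" if "y \<in># Y - X" for y
    using less Min_le[OF finite_set_mset that] by (rule less_le_trans)
  ultimately show ?thesis using ne unfolding below_iff by blast
qed

lemma below_if_edge_pos: "edge X Y > 0 \<Longrightarrow> below Y X"
  using below_if_edge_neg[of Y X] edge_swap[of X Y] by linarith

text \<open>
  Two nonempty differences are disjoint, so their minima cannot agree; an edge of zero thus only
  arises from an empty difference.
\<close>

lemma subset_if_edge_zero:
  assumes "edge X Y = 0"
  shows "X \<subseteq># Y \<or> Y \<subseteq># X"
proof (rule ccontr)
  assume "\<not> ?thesis"
  then have ne: "X - Y \<noteq> {#}" "Y - X \<noteq> {#}" by (simp_all add: Diff_eq_empty_iff_mset)
  then have "Min (set_mset (X - Y)) \<in># X - Y" "Min (set_mset (Y - X)) \<in># Y - X"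
    by (intro Min_in; simp)+
  moreover have "Min (set_mset (X - Y)) = Min (set_mset (Y - X))"
    using assms ne by (simp add: edge_def)
  ultimately show False by (metis in_diff_count less_asym)
qed

lemma below_if_larger_edge_nonpos:
  assumes "size X = Suc (size Y)" and "edge X Y \<le> 0"
  shows "below X Y"
proof (cases "edge X Y = 0")
  case True
  with assms(1) have "Y \<subset># X"
    using subset_if_edge_zero[of X Y] size_mset_mono[of X Y] by (auto simp: subset_mset.less_le)
  then show ?thesis by (rule subset_implies_multp)
next
  case False
  with assms(2) show ?thesis by (intro below_if_edge_neg) simp
qed

lemma eq_if_edge_zero: "size X = size Y \<Longrightarrow> edge X Y = 0 \<Longrightarrow> X = Y"
  using subset_if_edge_zero[of X Y] mset_subset_size[of X Y] mset_subset_size[of Y X]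
  by (auto simp: subset_mset.less_le)


section \<open>The positions won by the player to move\<close>

text \<open>
  The owner of \<open>X\<close> is on turn. The weak inequality for even \<open>k\<close> reflects that in the empty game the player
  on turn, unable to move, wins; a single \<open>\<star>\<close> is therefore lost, in accordance with the strict
  comparisons for odd \<open>k\<close>.
\<close>

definition winning :: "rat multiset \<Rightarrow> rat multiset \<Rightarrow> nat \<Rightarrow> bool" where
  "winning X Y k \<longleftrightarrow>
     (if even k then size Y \<le> size X
      else size Y < size X \<or> ((size Y = size X \<or> size Y = Suc (size X)) \<and> below Y X))"

text \<open>
  For an odd number of stars, \<open>\<not> winning X Y k\<close> with \<open>|X| = |Y|\<close> or \<open>|X| = |Y| - 1\<close> means that
  \<open>below X Y\<close> or \<open>X = Y\<close>. Lowering an element of \<open>X\<close> moves \<open>X\<close> strictly down in the order, and raising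
  or removing an element of \<open>Y\<close> moves \<open>Y\<close> strictly up, so after any of these moves the first multiset
  is strictly below the second. Everything else is decided by the sizes.
\<close>

lemma move_from_losing:
  assumes "move X Y k X' Y' k'" and "\<not> winning X Y k"
  shows "winning Y' X' k'"
  using assms
proof induction
  case (remove_own x X Y k)
  then show ?case by (auto simp: winning_def split: if_splits)
next
  case (remove_other X y Y k)
  then have "below X Y" if "odd k" "size X = size Y \<or> size X = Suc (size Y)"
    using that below_total[of X "add_mset y Y"] below_add_mset[where x = y and X = Y]
      below_trans[where X = X and Y = "add_mset y Y" and Z = Y]
    by (auto simp: winning_def)
  with remove_other show ?case by (auto simp: winning_def not_less le_Suc_eq split: if_splits)
next
  case (lower_own x X Y k)
  then have "below (add_mset (lower x) X) Y" if "odd k" "size Y = Suc (size X)"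
    using that below_total[of "add_mset x X" Y] below_replace[OF lower_less, of x X]
      below_trans[where X = "add_mset (lower x) X" and Y = "add_mset x X" and Z = Y]
    by (auto simp: winning_def)
  with lower_own show ?case by (auto simp: winning_def split: if_splits)
next
  case (own_to_star x X Y k)
  then show ?case by (auto simp: winning_def split: if_splits)
next
  case (raise_other y X Y k)
  then have "below X (add_mset (raise y) Y)" if "odd k" "size X = Suc (size Y)"
    using that below_total[of X "add_mset y Y"] below_replace[OF raise_greater, of y Y]
      below_trans[where X = X and Y = "add_mset y Y" and Z = "add_mset (raise y) Y"]
    by (auto simp: winning_def)
  with raise_other show ?case by (auto simp: winning_def split: if_splits)
next
  case (remove_star X Y k)
  then show ?case by (auto simp: winning_def split: if_splits)
qed

text \<open>
  Let \<open>C\<close> be the common part and \<open>m\<close> the least element of \<open>Y - X\<close>, which is smaller than every element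
  of \<open>X - Y\<close>. If \<open>Y - X\<close> has a second element, the mover removes it, and \<open>m\<close> still keeps \<open>Y\<close> below \<open>X\<close>. If
  not, then \<open>Y = C + {m}\<close>, and the sizes leave two cases: either \<open>X = C\<close>, where removing \<open>m\<close> makes the
  multisets equal, or \<open>X = C + {x}\<close> with \<open>m < x\<close>, where one of \<open>x\<close> and \<open>m\<close> is moved towards the other
  without crossing it.
\<close>

lemma good_move_if_below:
  assumes X: "all_positive X" and Y: "all_positive Y" and below: "below Y X" and "odd k"
    and size: "size Y = size X \<or> size Y = Suc (size X)"
  shows "\<exists>X' Y' k'. move X Y k X' Y' k' \<and> \<not> winning Y' X' k'"
proof -
  define C X' Y' where "C = X \<inter># Y" and "X' = X - Y" and "Y' = Y - X"
  have XC: "X = C + X'" and YC: "Y = C + Y'"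
    unfolding C_def X'_def Y'_def by (auto intro: multiset_eqI)
  define m where "m = Min (set_mset Y')"
  from below have "Y' \<noteq> {#}" and dom: "\<forall>x\<in>#X'. \<exists>y\<in>#Y'. y < x"
    unfolding below_iff X'_def Y'_def by auto
  then have "m \<in># Y'" unfolding m_def by (intro Min_in) auto
  then obtain Z where Z: "Y' = add_mset m Z" by (auto dest: multi_member_split)
  have m: "m < x" if "x \<in># X'" for x
    using that dom unfolding m_def by (meson Min_le finite_set_mset le_less_trans)
  show ?thesis
  proof (cases Z)
    case (add y Z')
    define W where "W = C + add_mset m Z'"
    have YW: "Y = add_mset y W" by (simp add: W_def YC Z add)
    have "below W X"
      unfolding W_def XC by (rule one_step_implies_multp) (auto dest: m)
    then have "\<not> below X W" using below_trans below_irrefl by blast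
    then have "\<not> winning W X k" using size \<open>odd k\<close> \<open>below W X\<close> by (auto simp: winning_def YW)
    then show ?thesis using move.remove_other[of X y W k] YW by blast
  next
    case empty
    then have YW: "Y = add_mset m C" by (simp add: YC Z)
    show ?thesis
    proof (cases X')
      case empty
      then have "\<not> winning C X k" using \<open>odd k\<close> by (simp add: XC winning_def below_irrefl)
      then show ?thesis using move.remove_other[of X m C k] YW by blast
    next
      case (add x X0)
      with size have "X0 = {#}" by (simp add: XC YW)
      with add have XW: "X = add_mset x C" by (simp add: XC)
      have x: "dyadic x" and m': "dyadic m" "m > 0" using X Y XW YW by auto
      have not_winning: "\<not> winning (add_mset b C) (add_mset a C) k" if "b \<le> a" for a b
      proof -
        have "\<not> below (add_mset a C) (add_mset b C)"
          using that below_replace[of b a C] below_trans below_irrefl by (metis nless_le)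
        then show ?thesis using \<open>odd k\<close> by (simp add: winning_def)
      qed
      from lower_or_raise_between[OF x m'(1)] m[of x] add
      consider "m \<le> lower x" | "den_exp m \<noteq> 0" "raise m \<le> x" by auto
      then show ?thesis
      proof cases
        case 1
        with m'(2) have "lower x > 0" by simp
        then show ?thesis using move.lower_own[of x C Y k] not_winning[OF 1] XW YW by blast
      next
        case 2
        then show ?thesis
          using move.raise_other[of m X C k] not_winning[OF 2(2)] XW YW by blast
      qed
    qed
  qed
qed

text \<open>
  With no move available the player on turn wins at once and there is no good move to exhibit,
  hence the premise that some move exists. For even \<open>k\<close> and \<open>Y = {#}\<close> there is nothing of the opponent to
  remove, so the mover makes a waiting move: give up a component of \<open>X\<close> while another one remains,
  lower a single remaining component (which may turn it into a star), or spend a star if \<open>X\<close> is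
  empty too.
\<close>

lemma good_move_from_winning:
  assumes X: "all_positive X" and Y: "all_positive Y" and win: "winning X Y k"
    and move: "move X Y k X0 Y0 k0"
  shows "\<exists>X' Y' k'. move X Y k X' Y' k' \<and> \<not> winning Y' X' k'"
proof (cases "odd k")
  case True
  then obtain j where j: "k = Suc j" "even j" by (metis even_Suc odd_pos gr0_implies_Suc)
  show ?thesis
  proof (cases "size Y < size X")
    case True
    then have "\<not> winning Y X j" using j by (simp add: winning_def)
    then show ?thesis using j move.remove_star by blast
  next
    case False
    then show ?thesis using good_move_if_below[OF X Y _ True] win True by (auto simp: winning_def)
  qed
next
  case False
  with win have le: "size Y \<le> size X" by (simp add: winning_def)
  show ?thesis
  proof (cases Y)
    case (add y W)
    then have "\<not> winning W X k" using le False by (simp add: winning_def)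
    then show ?thesis using add move.remove_other by blast
  next
    case empty
    show ?thesis
    proof (cases X)
      case empty
      with \<open>Y = {#}\<close> move obtain j where j: "k = Suc j" by (auto elim: move.cases)
      then have "\<not> winning Y X j"
        using False empty \<open>Y = {#}\<close> by (simp add: winning_def below_irrefl)
      then show ?thesis using j move.remove_star by blast
    next
      case (add x Z)
      show ?thesis
      proof (cases "Z = {#}")
        case False
        then have "\<not> winning Y Z k"
          using \<open>\<not> odd k\<close> empty by (simp add: winning_def nonempty_has_size)
        then show ?thesis using add move.remove_own by blast
      next
        case True
        from X add have "lower x \<ge> 0" using lower_nonneg by simp
        then consider "lower x > 0" | "lower x = 0" by linarith
        then show ?thesis
        proof cases
          case 1
          have "\<not> winning Y (add_mset (lower x) Z) k" using \<open>\<not> odd k\<close> empty by (simp add: winning_def)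
          then show ?thesis using add move.lower_own[OF 1] by blast
        next
          case 2
          have "\<not> winning Y Z (Suc k)"
            using \<open>\<not> odd k\<close> empty True by (simp add: winning_def below_irrefl)
          then show ?thesis using add move.own_to_star[OF 2] by blast
        qed
      qed
    qed
  qed
qed

lemma no_move_imp_winning: "(\<And>X' Y' k'. \<not> move X Y k X' Y' k') \<Longrightarrow> winning X Y k"
proof -
  assume none: "\<And>X' Y' k'. \<not> move X Y k X' Y' k'"
  have "Y = {#}" using none move.remove_other by (cases Y) blast+
  moreover have "k = 0" using none move.remove_star by (cases k) blast+
  ultimately show "winning X Y k" by (simp add: winning_def)
qed

text \<open>
  By induction on the game form: \<open>winning\<close> satisfies the recursion that defines the winner, as losing
  positions only have moves to positions won by the opponent and winning ones have a move to a
  position lost by the opponent or no move at all.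
\<close>

theorem wins_first_iff_winning:
  assumes "all_positive X" and "all_positive Y"
  shows "(left_wins_first (position X Y k) \<longleftrightarrow> winning X Y k) \<and>
    (right_wins_first (position X Y k) \<longleftrightarrow> winning Y X k)"
  using assms
proof (induction "size (position X Y k)" arbitrary: X Y k rule: less_induct)
  case less
  note pos = less.prems
  note left = left_option_iff_move[OF pos] and right = right_option_iff_move[OF pos]
  have IHl: "right_wins_first (position X' Y' k') \<longleftrightarrow> winning Y' X' k'"
    if "move X Y k X' Y' k'" for X' Y' k'
    using that less.hyps[of X' Y' k'] move_all_positive[OF that] pos left size_left_opts by blast
  have IHr: "left_wins_first (position X' Y' k') \<longleftrightarrow> winning X' Y' k'"
    if "move Y X k Y' X' k'" for X' Y' k'
    using that less.hyps[of X' Y' k'] move_all_positive[OF that] pos right size_right_opts by blast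
  have "left_wins_first (position X Y k) \<longleftrightarrow>
      (\<forall>X' Y' k'. \<not> move X Y k X' Y' k') \<or> (\<exists>X' Y' k'. move X Y k X' Y' k' \<and> \<not> winning Y' X' k')"
    unfolding left_wins_first.simps[of "position X Y k"] using left IHl by (metis all_not_fin_conv)
  moreover have "right_wins_first (position X Y k) \<longleftrightarrow>
      (\<forall>X' Y' k'. \<not> move Y X k Y' X' k') \<or> (\<exists>X' Y' k'. move Y X k Y' X' k' \<and> \<not> winning X' Y' k')"
    unfolding right_wins_first.simps[of "position X Y k"] using right IHr by (metis all_not_fin_conv)
  moreover have "winning A B k \<longleftrightarrow>
      (\<forall>A' B' k'. \<not> move A B k A' B' k') \<or> (\<exists>A' B' k'. move A B k A' B' k' \<and> \<not> winning B' A' k')"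
    if "all_positive A" "all_positive B" for A B
    using that good_move_from_winning no_move_imp_winning move_from_losing by metis
  ultimately show ?case using pos by metis
qed

theorem theorem3p4:
  fixes X Y :: "rat multiset" and G :: game
  assumes "\<forall>x\<in>#X. dyadic x \<and> x > 0" and "\<forall>y\<in>#Y. dyadic y \<and> y > 0"
    and "G = star_sum X Y"
  shows
    "(advantage X Y > 1 \<or> (advantage X Y \<in> {0, 1} \<and> edge X Y > 0)
        \<longrightarrow> misere_outcome (G + star) = Outcome_L) \<and>
     (advantage X Y < - 1 \<or> (advantage X Y \<in> {0, - 1} \<and> edge X Y < 0)
        \<longrightarrow> misere_outcome (G + star) = Outcome_R) \<and>
     ((advantage X Y = 1 \<and> edge X Y \<le> 0) \<or> (advantage X Y = - 1 \<and> edge X Y \<ge> 0)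
        \<longrightarrow> misere_outcome (G + star) = Outcome_N) \<and>
     (advantage X Y = 0 \<and> edge X Y = 0
        \<longrightarrow> misere_outcome (G + star) = Outcome_P)"
proof -
  have "G + star = position X Y 1" by (simp add: position_def assms(3))
  then have out: "misere_outcome (G + star) =
     (if winning X Y 1 then (if winning Y X 1 then Outcome_N else Outcome_L)
      else (if winning Y X 1 then Outcome_R else Outcome_P))"
    using assms(1,2) by (simp add: misere_outcome_def wins_first_iff_winning all_positive_def)
  have asym: "below A B \<Longrightarrow> \<not> below B A" for A B using below_trans below_irrefl by blast
  have neg: "edge X Y < 0 \<Longrightarrow> below X Y" and pos: "edge X Y > 0 \<Longrightarrow> below Y X"
    by (rule below_if_edge_neg below_if_edge_pos; assumption)+
  have one: "below X Y" if "advantage X Y = 1" "edge X Y \<le> 0"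
    using that by (intro below_if_larger_edge_nonpos) (auto simp: advantage_def)
  have minus_one: "below Y X" if "advantage X Y = - 1" "edge X Y \<ge> 0"
    using that by (intro below_if_larger_edge_nonpos) (auto simp: advantage_def edge_swap[of Y X])
  have zero: "X = Y" if "advantage X Y = 0" "edge X Y = 0"
    using that by (intro eq_if_edge_zero) (auto simp: advantage_def)
  show ?thesis
  proof (intro conjI impI)
    assume "advantage X Y > 1 \<or> (advantage X Y \<in> {0, 1} \<and> edge X Y > 0)"
    then have "winning X Y 1 \<and> \<not> winning Y X 1"
      using pos asym by (auto simp: winning_def advantage_def)
    then show "misere_outcome (G + star) = Outcome_L" by (simp add: out)
  next
    assume "advantage X Y < - 1 \<or> (advantage X Y \<in> {0, - 1} \<and> edge X Y < 0)"
    then have "\<not> winning X Y 1 \<and> winning Y X 1"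
      using neg asym by (auto simp: winning_def advantage_def)
    then show "misere_outcome (G + star) = Outcome_R" by (simp add: out)
  next
    assume "(advantage X Y = 1 \<and> edge X Y \<le> 0) \<or> (advantage X Y = - 1 \<and> edge X Y \<ge> 0)"
    then have "winning X Y 1 \<and> winning Y X 1"
      using one minus_one by (auto simp: winning_def advantage_def)
    then show "misere_outcome (G + star) = Outcome_N" by (simp add: out)
  next
    assume "advantage X Y = 0 \<and> edge X Y = 0"
    then have "\<not> winning X Y 1 \<and> \<not> winning Y X 1"
      using zero by (auto simp: winning_def below_irrefl)
    then show "misere_outcome (G + star) = Outcome_P" by (simp add: out)
  qed
qed

end
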